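(* Let $N,d\ge 1$ and let $G=(V,E)$, $V=\{1,\dots,N\}$, be an undirected connected simple graph, with $\Omega_n=\{\ell\in V : (n,\ell)\in E\}$ the set of neighbors of node $n$. For $n=1,\dots,N$ let $f_n:\mathbb{R}^d\to\mathbb{R}$ be of class $C^2$, coercive, and with Lipschitz continuous gradient $\nabla f_n$, and let $f=\sum_{n=1}^N f_n$. Let $\alpha_t=(t+1)^{-\tau_\alpha}$ and $\beta_t=(t+1)^{-\tau_\beta}$ with $0\le \tau_\beta<\tau_\alpha\le 1$. Suppose $(\mathbf{x}_n(t))_{n=1}^N$ is a solution, with arbitrary initial condition, of $$\dot{\mathbf{x}}_n(t)=\beta_t\sum_{\ell\in\Omega_n}(\mathbf{x}_\ell(t)-\mathbf{x}_n(t))-\alpha_t\nabla f_n(\mathbf{x}_n(t)),\qquad n=1,\dots,N.$$ Then for each $n=1,\dots,N$: (i) $\lim_{t\to\infty}\|\mathbf{x}_n(t)-\mathbf{x}_\ell(t)\|=0$ for $\ell=1,\dots,N$; (ii) $\mathbf{x}_n(t)$ converges, as $t\to\infty$, to the set of critical points of $f$.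
   Context: A solution is a $C^1$ map $t\mapsto(\mathbf{x}_n(t))_{n=1}^N\in\mathbb{R}^{Nd}$ on $[0,\infty)$ satisfying the system for all $t$ (under the Lipschitz gradient hypothesis solutions exist and are unique). Critical points of $f$ are the points $x$ with $\nabla f(x)=0$. Convergence to a set means that the distance to the set tends to $0$. $\|\cdot\|$ is the Euclidean norm. A function $g:\mathbb{R}^d\to\mathbb{R}$ is coercive if $g(x)\to\infty$ as $\|x\|\to\infty$. *)

theory Defs
  imports "HOL-Analysis.Analysis" "Graph_Theory.Digraph_Component"
begin

(* Meaningful only where f is differentiable; the gradient is then unique. *)
definition gradient :: "('a::real_inner \<Rightarrow> real) \<Rightarrow> 'a \<Rightarrow> 'a" where
  "gradient f x = (THE D. GDERIV f x :> D)"

definition critical_points :: "('a::real_inner \<Rightarrow> real) \<Rightarrow> 'a set" where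
  "critical_points f = {x. gradient f x = 0}"

definition C2 :: "('a::real_normed_vector \<Rightarrow> 'b::real_normed_vector) \<Rightarrow> bool" where
  "C2 f \<longleftrightarrow> (\<exists>(f' :: 'a \<Rightarrow> 'a \<Rightarrow>\<^sub>L 'b) (f'' :: 'a \<Rightarrow> 'a \<Rightarrow>\<^sub>L ('a \<Rightarrow>\<^sub>L 'b)).
     (\<forall>x. (f has_derivative blinfun_apply (f' x)) (at x)) \<and>
     (\<forall>x. (f' has_derivative blinfun_apply (f'' x)) (at x)) \<and>
     continuous_on UNIV f'')"

definition coercive :: "('a::real_normed_vector \<Rightarrow> real) \<Rightarrow> bool" where
  "coercive g \<longleftrightarrow> filterlim g at_top at_infinity"

(* The condition on S is needed because infdist y {} = 0 by convention:
   nothing converges to the empty set. *)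
definition converges_to_set :: "(real \<Rightarrow> 'a::metric_space) \<Rightarrow> 'a set \<Rightarrow> bool" where
  "converges_to_set y S \<longleftrightarrow> S \<noteq> {} \<and> ((\<lambda>t. infdist (y t) S) \<longlongrightarrow> 0) at_top"

definition neighbors :: "'v pair_pre_digraph \<Rightarrow> 'v \<Rightarrow> 'v set" where
  "neighbors G n = {l \<in> pverts G. (n, l) \<in> parcs G}"

definition dgf_rhs ::
  "'v pair_pre_digraph \<Rightarrow> ('v \<Rightarrow> 'a::real_inner \<Rightarrow> real) \<Rightarrow> (real \<Rightarrow> real) \<Rightarrow> (real \<Rightarrow> real)
    \<Rightarrow> real \<Rightarrow> ('v \<Rightarrow> 'a) \<Rightarrow> 'v \<Rightarrow> 'a" where
  "dgf_rhs G f \<alpha> \<beta> t y n =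
     \<beta> t *\<^sub>R (\<Sum>l\<in>neighbors G n. y l - y n) - \<alpha> t *\<^sub>R gradient (f n) (y n)"

(* x n is the n-th component of the solution; only its values on [0, \<infinity>) matter,
   and the derivative at t = 0 is one-sided. *)
definition dgf_solution ::
  "'v pair_pre_digraph \<Rightarrow> ('v \<Rightarrow> 'a::real_inner \<Rightarrow> real) \<Rightarrow> (real \<Rightarrow> real) \<Rightarrow> (real \<Rightarrow> real)
    \<Rightarrow> ('v \<Rightarrow> real \<Rightarrow> 'a) \<Rightarrow> bool" where
  "dgf_solution G f \<alpha> \<beta> x \<longleftrightarrow>
     (\<forall>n\<in>pverts G. \<exists>x'. continuous_on {0..} x' \<and>
        (\<forall>t\<ge>0. (x n has_vector_derivative x' t) (at t within {0..}) \<and>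
                x' t = dgf_rhs G f \<alpha> \<beta> t (\<lambda>l. x l t) n))"

end

theory Submission
  imports Defs "HOL-Real_Asymp.Real_Asymp"
begin

text \<open>
  Subtract lower bounds so that all \<open>f\<^sub>n \<ge> 0\<close>, and put \<open>\<gamma> = \<beta> / \<alpha>\<close>, \<open>F = \<Sum>\<^sub>n f\<^sub>n(x\<^sub>n)\<close> and
  \<open>Q = \<Sum> \<bar>x\<^sub>n - x\<^sub>l\<bar>\<^sup>2\<close> over the edges. The flow is \<open>x' = - \<alpha> \<nabla>E\<close> for \<open>E = F + \<gamma> Q / 2\<close>, so
  \<open>E' = - \<bar>x'\<bar>\<^sup>2 / \<alpha> + \<gamma>' Q / 2\<close>. The second term is dangerous because \<open>\<gamma>\<close> grows, but connectivity of
  the graph and \<open>\<bar>\<nabla>f\<^sub>n\<bar>\<^sup>2 \<le> 4 K f\<^sub>n\<close> (a consequence of the Lipschitz gradient) give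
  \<open>Q' \<le> - \<beta> \<mu> Q + (\<alpha>\<^sup>2 / \<beta>) 4 K F\<close>. Adding \<open>c (t + 1)\<^bsup>\<tau>\<^sub>\<alpha> - 1\<^esup> Q\<close> to \<open>E\<close> therefore yields a quantity \<open>P\<close>
  with \<open>P' \<le> - \<bar>x'\<bar>\<^sup>2 / \<alpha> + h P\<close>, where \<open>h\<close> is a multiple of \<open>(t + 1)\<^bsup>- (\<tau>\<^sub>\<alpha> - \<tau>\<^sub>\<beta>) - 1\<^esup>\<close> and hence
  integrable. So \<open>E\<close> is bounded, which gives \<open>Q \<le> 2 E / \<gamma> \<rightarrow> 0\<close> (consensus) and, by coercivity,
  boundedness of the trajectories; moreover \<open>\<integral> \<alpha> \<bar>\<Sum>\<^sub>n \<nabla>f\<^sub>n(x\<^sub>n)\<bar>\<^sup>2 dt < \<infinity>\<close>. The mean of the \<open>x\<^sub>n\<close> moves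
  with speed \<open>O(\<alpha>)\<close> and \<open>\<integral> \<alpha> dt = \<infinity>\<close>, so a Barbalat argument shows that \<open>\<nabla>f\<close> vanishes along the
  mean in the limit, and compactness turns this into convergence to the critical points.
\<close>

section \<open>Gradients and coercive functions\<close>

lemma GDERIV_unique:
  assumes "GDERIV f x :> D" "GDERIV f x :> D'"
  shows "D = D'"
proof -
  have "(\<lambda>h. inner h D) = (\<lambda>h. inner h D')"
    using assms unfolding gderiv_def by (rule has_derivative_unique)
  then have "inner h D = inner h D'" for h by meson
  then show ?thesis
    by (metis vector_eq_ldot)
qed

lemma gradient_eqI: "GDERIV f x :> D \<Longrightarrow> gradient f x = D"
  unfolding gradient_def by (blast intro: the_equality GDERIV_unique)

text \<open>Riesz representation in coordinates: the derivative functional is the inner product with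
  the vector of its values on the basis.\<close>

lemma C2_GDERIV_gradient:
  fixes f :: "'a::euclidean_space \<Rightarrow> real"
  assumes "C2 f"
  shows "GDERIV f x :> gradient f x"
proof -
  from assms obtain f' :: "'a \<Rightarrow> 'a \<Rightarrow>\<^sub>L real" where "(f has_derivative blinfun_apply (f' x)) (at x)"
    unfolding C2_def by blast
  moreover have "blinfun_apply (f' x) = (\<lambda>h. inner h (\<Sum>b\<in>Basis. f' x b *\<^sub>R b))"
  proof
    fix h
    have "f' x h = f' x (\<Sum>b\<in>Basis. inner h b *\<^sub>R b)"
      by (simp add: euclidean_representation)
    also have "\<dots> = inner h (\<Sum>b\<in>Basis. f' x b *\<^sub>R b)"
      by (simp add: blinfun.sum_right blinfun.scaleR_right inner_sum_right mult.commute)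
    finally show "f' x h = inner h (\<Sum>b\<in>Basis. f' x b *\<^sub>R b)" .
  qed
  ultimately have "GDERIV f x :> (\<Sum>b\<in>Basis. f' x b *\<^sub>R b)"
    by (simp add: gderiv_def)
  then show ?thesis
    using gradient_eqI by metis
qed

lemma gradient_sum:
  assumes "\<And>m. m \<in> A \<Longrightarrow> GDERIV (f m) x :> gradient (f m) x"
  shows "gradient (\<lambda>y. \<Sum>m\<in>A. f m y) x = (\<Sum>m\<in>A. gradient (f m) x)"
proof (rule gradient_eqI)
  show "GDERIV (\<lambda>y. \<Sum>m\<in>A. f m y) x :> (\<Sum>m\<in>A. gradient (f m) x)"
    using assms unfolding gderiv_def inner_sum_right by (intro has_derivative_sum)
qed

lemma GDERIV_vector_derivative_compose:
  assumes "GDERIV f (x t) :> D" "(x has_vector_derivative x') (at t)"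
  shows "((\<lambda>t. f (x t)) has_real_derivative inner x' D) (at t)"
  using has_derivative_compose[OF assms(2)[unfolded has_vector_derivative_def]
      assms(1)[unfolded gderiv_def]]
  by (simp add: has_field_derivative_def mult_commute_abs)

lemma coercive_bounded_sublevel:
  assumes "coercive f"
  obtains R where "\<And>x. f x \<le> C \<Longrightarrow> norm x \<le> R"
proof -
  have "eventually (\<lambda>x. f x \<ge> C + 1) at_infinity"
    using assms unfolding coercive_def filterlim_at_top by blast
  then obtain R where "\<And>x. norm x \<ge> R \<Longrightarrow> f x \<ge> C + 1"
    unfolding eventually_at_infinity by blast
  then have "f x \<le> C \<Longrightarrow> norm x \<le> R" for x
    by (smt (verit))
  then show ?thesis
    using that by blast
qed

text \<open>Where \<open>f\<close> is nonpositive the argument stays in a closed ball, and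
  \<open>f\<close> is bounded on that ball by compactness; elsewhere \<open>f\<close> is
  positive.\<close>

lemma coercive_bounded_below:
  fixes f :: "'a::{real_normed_vector,heine_borel} \<Rightarrow> real"
  assumes "coercive f" "continuous_on UNIV f"
  obtains m where "\<And>x. m \<le> f x"
proof -
  obtain R where R: "\<And>x. f x \<le> 0 \<Longrightarrow> norm x \<le> R"
    using coercive_bounded_sublevel[OF assms(1)] by blast
  have "bounded (f ` cball 0 R)"
    by (intro compact_imp_bounded compact_continuous_image
        continuous_on_subset[OF assms(2)]) auto
  then obtain B where "\<forall>x\<in>cball 0 R. \<bar>f x\<bar> \<le> B"
    unfolding bounded_iff by auto
  then have B: "norm x \<le> R \<Longrightarrow> \<bar>f x\<bar> \<le> B" for x
    by simp
  have "- \<bar>B\<bar> \<le> f x" for x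
    using R[of x] B[of x] by linarith
  then show ?thesis
    using that by blast
qed

text \<open>A step of size 1/(2L) against the gradient lowers \<open>f\<close> by at least the
  squared gradient norm over 4L, and \<open>f\<close> cannot fall below \<open>m\<close>.\<close>

lemma norm_gradient_squared_le:
  assumes f: "\<And>x. GDERIV f x :> g x" and lip: "L-lipschitz_on UNIV g"
    and L: "L > 0" and m: "\<And>x. m \<le> f x"
  shows "(norm (g x))\<^sup>2 \<le> 4 * L * (f x - m)"
proof -
  define p where "p = g x"
  \<comment> \<open>Within this step size the gradient changes by at most half of its initial norm,
    so half of the descent rate survives.\<close>
  define h where "h = 1 / (2 * L)"
  have h: "h > 0" using L by (simp add: h_def)
  define \<phi> where "\<phi> s = f (x - s *\<^sub>R p)" for s
  have "(\<phi> has_real_derivative inner (- p) (g (x - s *\<^sub>R p))) (at s)" for s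
    unfolding \<phi>_def
    by (rule GDERIV_vector_derivative_compose[OF f]) (auto intro!: derivative_eq_intros)
  then obtain z where z: "0 < z" "z < h" "\<phi> h - \<phi> 0 = (h - 0) * inner (- p) (g (x - z *\<^sub>R p))"
    using MVT2[OF h, of \<phi> "\<lambda>s. inner (- p) (g (x - s *\<^sub>R p))"] by blast
  have "norm (p - g (x - z *\<^sub>R p)) \<le> L * (z * norm p)"
    using lipschitz_onD[OF lip, of x "x - z *\<^sub>R p"] z(1) by (simp add: p_def dist_norm)
  also have "\<dots> \<le> L * (h * norm p)"
    using z L by (intro mult_left_mono mult_right_mono) auto
  also have "\<dots> = norm p / 2"
    using L by (simp add: h_def)
  finally have "inner p (p - g (x - z *\<^sub>R p)) \<le> norm p * (norm p / 2)"
    by (meson norm_cauchy_schwarz mult_left_mono norm_ge_zero order_trans)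
  then have "(norm p)\<^sup>2 / 2 \<le> inner p (g (x - z *\<^sub>R p))"
    by (simp add: inner_diff_right power2_norm_eq_inner[symmetric] power2_eq_square)
  then have "h * ((norm p)\<^sup>2 / 2) \<le> h * inner p (g (x - z *\<^sub>R p))"
    using h by (intro mult_left_mono) auto
  also have "\<dots> = f x - f (x - h *\<^sub>R p)"
    using z(3) by (simp add: \<phi>_def)
  also have "\<dots> \<le> f x - m"
    using m by simp
  finally show ?thesis
    using L by (simp add: h_def p_def field_simps)
qed

lemma norm_sum_squared_le:
  fixes v :: "'i \<Rightarrow> 'a::real_normed_vector"
  shows "(norm (\<Sum>i\<in>A. v i))\<^sup>2 \<le> card A * (\<Sum>i\<in>A. (norm (v i))\<^sup>2)"
proof -
  have "(norm (\<Sum>i\<in>A. v i))\<^sup>2 \<le> (\<Sum>i\<in>A. norm (v i))\<^sup>2"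
    by (intro power_mono norm_sum) auto
  also have "\<dots> \<le> card A * (\<Sum>i\<in>A. (norm (v i))\<^sup>2)"
    using sum_squared_le_sum_of_squares[of "\<lambda>i. norm (v i)" A] by (simp add: mult.commute)
  finally show ?thesis .
qed

section \<open>Limits along curves: zero sets, intrinsic time and a Barbalat argument\<close>

text \<open>On the part of a zero-free closed set inside the ball of radius \<open>R\<close>,
  compactness keeps \<open>g\<close> away from 0, so the curve eventually avoids that set.\<close>

lemma converges_to_set_zeros:
  fixes y :: "real \<Rightarrow> 'a::{real_normed_vector,heine_borel}"
    and g :: "'a \<Rightarrow> 'b::real_normed_vector"
  assumes g: "continuous_on UNIV g"
    and bdd: "eventually (\<lambda>t. norm (y t) \<le> R) at_top"
    and lim: "((\<lambda>t. g (y t)) \<longlongrightarrow> 0) at_top"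
  shows "converges_to_set y {z. g z = 0}"
proof -
  have avoid: "eventually (\<lambda>t. y t \<notin> C) at_top"
    if C: "closed C" "\<And>z. z \<in> C \<Longrightarrow> g z \<noteq> 0" for C
  proof (cases "C \<inter> cball 0 R = {}")
    case True
    show ?thesis
      using bdd by eventually_elim (use True in auto)
  next
    case False
    have "compact (C \<inter> cball 0 R)"
      using C(1) by (simp add: closed_Int_compact)
    moreover have "continuous_on (C \<inter> cball 0 R) (\<lambda>z. norm (g z))"
      by (intro continuous_on_norm continuous_on_subset[OF g]) auto
    ultimately obtain z where z: "z \<in> C" "\<And>u. u \<in> C \<inter> cball 0 R \<Longrightarrow> norm (g z) \<le> norm (g u)"
      using continuous_attains_inf[of "C \<inter> cball 0 R" "\<lambda>z. norm (g z)"] False by blast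
    have "eventually (\<lambda>t. norm (g (y t)) < norm (g z)) at_top"
      using tendstoD[OF lim, of "norm (g z)"] C(2)[OF z(1)] by (simp add: dist_norm)
    with bdd show ?thesis
      by eventually_elim (use z(2) in force)
  qed
  show ?thesis
    unfolding converges_to_set_def
  proof
    \<comment> \<open>If \<open>g\<close> had no zero, the curve would eventually have to avoid the
      whole space.\<close>
    show "{z. g z = 0} \<noteq> {}"
      using avoid[of UNIV] by auto
    show "((\<lambda>t. infdist (y t) {z. g z = 0}) \<longlongrightarrow> 0) at_top"
    proof (rule tendstoI)
      fix e :: real assume e: "e > 0"
      have "closed {z. e \<le> infdist z {z. g z = 0}}"
        by (intro closed_Collect_le continuous_intros)
      then have "eventually (\<lambda>t. y t \<notin> {z. e \<le> infdist z {z. g z = 0}}) at_top"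
        using e by (intro avoid) auto
      then show "eventually (\<lambda>t. dist (infdist (y t) {z. g z = 0}) 0 < e) at_top"
        by eventually_elim (simp add: infdist_nonneg)
    qed
  qed
qed

text \<open>Supplies the intrinsic time. The bound on \<tau> makes the integral of the weight
  diverge, with a logarithm in the borderline case.\<close>

lemma powr_antiderivative_at_top:
  fixes \<tau> :: real
  assumes "\<tau> \<le> 1"
  obtains S where "\<And>t. t \<ge> 0 \<Longrightarrow> (S has_real_derivative (t + 1) powr (- \<tau>)) (at t)"
    and "filterlim S at_top at_top"
proof (cases "\<tau> = 1")
  case True
  show ?thesis
  proof (rule that)
    show "((\<lambda>t. ln (t + 1)) has_real_derivative (t + 1) powr (- \<tau>)) (at t)" if "t \<ge> 0" for t
      using that True by (auto intro!: derivative_eq_intros simp: powr_minus divide_inverse)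
    show "filterlim (\<lambda>t. ln (t + 1) :: real) at_top at_top"
      by real_asymp
  qed
next
  case False
  show ?thesis
  proof (rule that)
    show "((\<lambda>t. (t + 1) powr (1 - \<tau>) / (1 - \<tau>)) has_real_derivative (t + 1) powr (- \<tau>)) (at t)"
      if "t \<ge> 0" for t
      using that False by (auto intro!: derivative_eq_intros)
    show "filterlim (\<lambda>t. (t + 1) powr (1 - \<tau>) / (1 - \<tau>)) at_top at_top"
      using assms False by real_asymp
  qed
qed

lemma lipschitz_diff_tendsto_0:
  fixes h :: "'a::real_normed_vector \<Rightarrow> 'b::real_normed_vector"
  assumes "C-lipschitz_on UNIV h" "((\<lambda>t. u t - v t) \<longlongrightarrow> 0) F"
  shows "((\<lambda>t. h (u t) - h (v t)) \<longlongrightarrow> 0) F"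
proof (rule Lim_null_comparison)
  show "\<forall>\<^sub>F t in F. norm (h (u t) - h (v t)) \<le> C * norm (u t - v t)"
    using lipschitz_onD[OF assms(1)] by (simp add: dist_norm)
  show "((\<lambda>t. C * norm (u t - v t)) \<longlongrightarrow> 0) F"
    using tendsto_mult_right_zero[OF tendsto_norm_zero[OF assms(2)]] .
qed

text \<open>A variant of Barbalat's lemma: measured in the intrinsic time \<open>S\<close>, the curve \<open>y\<close> has bounded speed,
  so each time at which \<open>w (y t)\<close> is large costs a fixed amount of the nonnegative quantity \<open>Z\<close>.\<close>

lemma tendsto_zero_if_dissipated:
  fixes Z S \<alpha> :: "real \<Rightarrow> real" and y :: "real \<Rightarrow> 'a::real_normed_vector"
    and w :: "'a \<Rightarrow> 'b::real_normed_vector"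
  assumes Z: "\<And>t. t \<ge> T \<Longrightarrow> (Z has_real_derivative Z' t) (at t)"
    and Z'_le: "\<And>t. t \<ge> T \<Longrightarrow> Z' t \<le> - c * \<alpha> t * (norm (g t))\<^sup>2"
    and Z_nonneg: "\<And>t. t \<ge> T \<Longrightarrow> 0 \<le> Z t" and c: "c > 0"
    and \<alpha>: "\<And>t. t \<ge> T \<Longrightarrow> \<alpha> t \<ge> 0"
    and S: "\<And>t. t \<ge> T \<Longrightarrow> (S has_real_derivative \<alpha> t) (at t)"
    and S_top: "filterlim S at_top at_top"
    and y: "\<And>t. t \<ge> T \<Longrightarrow> (y has_vector_derivative y' t) (at t)"
    and y'_le: "\<And>t. t \<ge> T \<Longrightarrow> norm (y' t) \<le> M * \<alpha> t"
    and w: "K-lipschitz_on UNIV w"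
    and gw: "((\<lambda>t. g t - w (y t)) \<longlongrightarrow> 0) at_top"
  shows "((\<lambda>t. w (y t)) \<longlongrightarrow> 0) at_top"
proof (rule tendstoI)
  fix e :: real assume e: "e > 0"
  have K: "K \<ge> 0" using lipschitz_on_nonneg[OF w] .
  \<comment> \<open>During intrinsic time \<eta> the value \<open>w (y t)\<close> moves by at most
    e/4. The summand 1 keeps the denominator positive when \<open>K\<close> or \<open>M\<close>
    vanishes.\<close>
  define \<eta> where "\<eta> = e / (4 * (K * \<bar>M\<bar> + 1))"
  have KM: "K * \<bar>M\<bar> + 1 > 0" using K by (simp add: add_nonneg_pos)
  have \<eta>: "\<eta> > 0" using e KM by (simp add: \<eta>_def)
  have KM\<eta>: "K * (\<bar>M\<bar> * \<eta>) \<le> e / 4"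
  proof -
    have "K * (\<bar>M\<bar> * \<eta>) \<le> (K * \<bar>M\<bar> + 1) * \<eta>"
      using \<eta> by (simp add: algebra_simps)
    also have "\<dots> = e / 4"
      using KM unfolding \<eta>_def by (simp add: divide_simps)
    finally show ?thesis .
  qed
  \<comment> \<open>The least amount that \<open>Z\<close> loses in intrinsic time \<eta> while
    \<open>norm (g t)\<close> is at least e/2.\<close>
  define \<kappa> where "\<kappa> = c * (e / 2)\<^sup>2 * \<eta>"
  have \<kappa>: "\<kappa> > 0" using c e \<eta> by (simp add: \<kappa>_def)
  have Z_anti: "Z v \<le> Z u" if "T \<le> u" "u \<le> v" for u v
  proof (rule DERIV_nonpos_imp_nonincreasing[OF that(2)])
    fix r assume r: "u \<le> r" "r \<le> v"
    have "Z' r \<le> 0"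
      using Z'_le[of r] \<alpha>[of r] c that r
      by (smt (verit) mult_nonneg_nonneg mult_minus_left zero_le_power2)
    then show "\<exists>d. (Z has_real_derivative d) (at r) \<and> d \<le> 0"
      using Z[of r] that r by auto
  qed
  define m where "m = Inf (Z ` {T..})"
  have bdd: "bdd_below (Z ` {T..})"
    by (rule bdd_belowI[of _ 0]) (auto simp: Z_nonneg)
  have m_le: "m \<le> Z t" if "t \<ge> T" for t
    unfolding m_def using that bdd by (intro cInf_lower) auto
  \<comment> \<open>From \<open>T1\<close> on, less than \<kappa> is left to lose above the infimum
    \<open>m\<close>.\<close>
  obtain T1 where T1: "T1 \<ge> T" "Z T1 < m + \<kappa>"
  proof -
    have "\<exists>z\<in>Z ` {T..}. z < m + \<kappa>"
      using cInf_lessD[of "Z ` {T..}" "m + \<kappa>"] \<kappa> unfolding m_def by auto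
    then show ?thesis using that by auto
  qed
  obtain T2 where T2: "\<And>t. t \<ge> T2 \<Longrightarrow> norm (g t - w (y t)) < e / 4"
    using tendstoD[OF gw, of "e / 4"] e unfolding eventually_at_top_linorder by auto
  have "norm (w (y t)) < e" if t: "t \<ge> max T1 T2" for t
  proof (rule ccontr)
    assume "\<not> norm (w (y t)) < e"
    then have big: "norm (w (y t)) \<ge> e" by simp
    have tT: "t \<ge> T" "t \<ge> T1" "t \<ge> T2" using t T1 by auto
    obtain v where v: "v \<ge> t" "S v \<ge> S t + \<eta>"
      using S_top unfolding filterlim_at_top eventually_at_top_linorder by (metis linear)
    have "continuous_on {t..v} S"
      using tT by (intro continuous_at_imp_continuous_on ballI DERIV_isCont[OF S]) auto
    \<comment> \<open>The time at which the intrinsic clock has advanced by exactly \<eta>.\<close>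
    then obtain u where u: "t \<le> u" "u \<le> v" "S u = S t + \<eta>"
      using IVT'[of S t "S t + \<eta>" v] v \<eta> by auto
    have S_mono: "S r1 \<le> S r2" if "t \<le> r1" "r1 \<le> r2" for r1 r2
      using that tT S \<alpha> by (intro DERIV_nonneg_imp_nondecreasing[of r1 r2 S]) (meson order_trans)+
    have g_ge: "norm (g r) \<ge> e / 2" if r: "t \<le> r" "r \<le> u" for r
    proof -
      have "norm (y r - y t) \<le> \<bar>M\<bar> * S r - \<bar>M\<bar> * S t"
      proof (cases "t = r")
        case False
        show ?thesis
        proof (rule differentiable_bound_general[where f' = y' and \<phi>' = "\<lambda>x. \<bar>M\<bar> * \<alpha> x"])
          show "t < r" using False r by simp
          show "continuous_on {t..r} y"
            using tT by (intro continuous_at_imp_continuous_on ballI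
                has_vector_derivative_continuous[OF y]) auto
          show "continuous_on {t..r} (\<lambda>x. \<bar>M\<bar> * S x)"
            using \<open>continuous_on {t..v} S\<close> r u
            by (intro continuous_intros) (auto elim: continuous_on_subset)
        next
          fix s assume s: "t < s" "s < r"
          then have sT: "s \<ge> T" using tT by simp
          show "(y has_vector_derivative y' s) (at s)" using y sT .
          show "((\<lambda>x. \<bar>M\<bar> * S x) has_vector_derivative \<bar>M\<bar> * \<alpha> s) (at s)"
            using S[OF sT] unfolding has_real_derivative_iff_has_vector_derivative[symmetric]
            by (rule DERIV_cmult)
          show "norm (y' s) \<le> \<bar>M\<bar> * \<alpha> s"
            using y'_le[OF sT] \<alpha>[OF sT] by (smt (verit) mult_right_mono)
        qed
      qed simp
      also have "\<dots> = \<bar>M\<bar> * (S r - S t)" by (simp add: algebra_simps)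
      also have "\<dots> \<le> \<bar>M\<bar> * \<eta>"
        using S_mono[of r u] r u by (intro mult_left_mono) auto
      finally have "norm (w (y r) - w (y t)) \<le> K * (\<bar>M\<bar> * \<eta>)"
        using lipschitz_onD[OF w, of "y r" "y t"] K
        by (smt (verit) UNIV_I dist_norm mult_left_mono)
      then have "norm (w (y r) - w (y t)) \<le> e / 4" using KM\<eta> by linarith
      moreover have "norm (g r - w (y r)) < e / 4" using T2 r tT by simp
      moreover have "norm (w (y t)) \<le> norm (w (y r) - w (y t)) + norm (g r - w (y r)) + norm (g r)"
        using norm_triangle_sub[of "w (y t)" "w (y r)"] norm_triangle_sub[of "w (y r)" "g r"]
        by (simp add: norm_minus_commute)
      ultimately show ?thesis using big by linarith
    qed
    \<comment> \<open>The added multiple of \<open>S\<close> grows no faster than \<open>Z\<close>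
      decays, which turns the elapsed intrinsic time into a loss of \<kappa>.\<close>
    have "Z u + c * (e / 2)\<^sup>2 * S u \<le> Z t + c * (e / 2)\<^sup>2 * S t"
    proof (rule DERIV_nonpos_imp_nonincreasing[OF u(1)])
      fix r assume r: "t \<le> r" "r \<le> u"
      then have rT: "r \<ge> T" using tT by simp
      have "((\<lambda>s. Z s + c * (e / 2)\<^sup>2 * S s) has_real_derivative Z' r + c * (e / 2)\<^sup>2 * \<alpha> r) (at r)"
        using Z[OF rT] S[OF rT] by (auto intro!: derivative_eq_intros)
      moreover have "c * \<alpha> r * (e / 2)\<^sup>2 \<le> c * \<alpha> r * (norm (g r))\<^sup>2"
        using c \<alpha>[OF rT] g_ge[OF r] e by (intro mult_left_mono power_mono) auto
      then have "Z' r + c * (e / 2)\<^sup>2 * \<alpha> r \<le> 0"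
        using Z'_le[OF rT] by (simp add: mult_ac)
      ultimately show "\<exists>d. ((\<lambda>s. Z s + c * (e / 2)\<^sup>2 * S s) has_real_derivative d) (at r) \<and> d \<le> 0"
        by blast
    qed
    then have "Z u \<le> Z t - \<kappa>"
      using u(3) by (simp add: \<kappa>_def algebra_simps)
    then show False
      using m_le[of u] Z_anti[of T1 t] T1 tT u by linarith
  qed
  then show "eventually (\<lambda>t. dist (w (y t)) 0 < e) at_top"
    unfolding eventually_at_top_linorder by (metis dist_0_norm dist_commute)
qed

section \<open>The graph Laplacian\<close>

text \<open>In a symmetric digraph without loops each undirected edge occurs as two arcs; the factor
  1/2 counts it once.\<close>

definition dirichlet_energy :: "'v pair_pre_digraph \<Rightarrow> ('v \<Rightarrow> 'a::real_inner) \<Rightarrow> real" where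
  "dirichlet_energy G y = (\<Sum>(n, l)\<in>parcs G. (norm (y n - y l))\<^sup>2) / 2"

text \<open>Sign convention of the positive semidefinite Laplacian; the coupling term of the flow is
  its negative.\<close>

definition laplacian :: "'v pair_pre_digraph \<Rightarrow> ('v \<Rightarrow> 'a::real_inner) \<Rightarrow> 'v \<Rightarrow> 'a" where
  "laplacian G y n = (\<Sum>l\<in>neighbors G n. y n - y l)"

lemma dirichlet_energy_nonneg: "0 \<le> dirichlet_energy G y"
  unfolding dirichlet_energy_def by (auto intro!: sum_nonneg)

context pair_graph
begin

lemma sum_arcs_swap: "(\<Sum>(n, l)\<in>parcs G. h n l) = (\<Sum>(n, l)\<in>parcs G. h l n)"
  for h :: "'a \<Rightarrow> 'a \<Rightarrow> 'b::comm_monoid_add"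
  by (rule sum.reindex_bij_witness[of _ prod.swap prod.swap]) (auto intro: arcs_symmetric)

lemma sum_neighbors: "(\<Sum>n\<in>pverts G. \<Sum>l\<in>neighbors G n. h n l) = (\<Sum>(n, l)\<in>parcs G. h n l)"
  for h :: "'a \<Rightarrow> 'a \<Rightarrow> 'b::comm_monoid_add"
proof -
  have "(SIGMA n:pverts G. neighbors G n) = parcs G"
    using arc_fst_in_verts arc_snd_in_verts by (force simp: neighbors_def)
  then show ?thesis
    using sum.Sigma[of "pverts G" "neighbors G" h] pair_finite_verts
    by (simp add: neighbors_def)
qed

text \<open>Discrete Green identity: average the sum over arcs with its copy under reversal of arcs.
  For \<open>z = y\<close> the right side is the Dirichlet energy.\<close>

lemma sum_inner_laplacian:
  "(\<Sum>n\<in>pverts G. inner (z n) (laplacian G y n))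
    = (\<Sum>(n, l)\<in>parcs G. inner (z n - z l) (y n - y l)) / 2"
proof -
  let ?A = "\<Sum>(n, l)\<in>parcs G. inner (z n) (y n - y l)"
  have "(\<Sum>n\<in>pverts G. inner (z n) (laplacian G y n)) = ?A"
    by (simp add: laplacian_def inner_sum_right sum_neighbors)
  moreover have "?A = - (\<Sum>(n, l)\<in>parcs G. inner (z l) (y n - y l))"
    by (subst sum_arcs_swap) (auto intro!: sum.cong simp: inner_diff_right sum_negf[symmetric])
  moreover have "(\<Sum>(n, l)\<in>parcs G. inner (z n - z l) (y n - y l))
      = ?A - (\<Sum>(n, l)\<in>parcs G. inner (z l) (y n - y l))"
    by (simp add: sum_subtractf[symmetric] case_prod_beta inner_diff_left)
  ultimately show ?thesis
    by simp
qed

text \<open>Test the Green identity with constant functions.\<close>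

lemma sum_laplacian: "(\<Sum>n\<in>pverts G. laplacian G y n) = 0"
proof -
  have "inner u (\<Sum>n\<in>pverts G. laplacian G y n) = 0" for u
    using sum_inner_laplacian[of "\<lambda>_. u" y] by (simp add: inner_sum_right)
  then show ?thesis
    using inner_eq_zero_iff by blast
qed

lemma arc_diff_le: "norm (y n - y l) \<le> sqrt (dirichlet_energy G y)" if "(n, l) \<in> parcs G"
proof (rule real_le_rsqrt)
  have "n \<noteq> l" using pair_no_loops[OF that] by simp
  have "(\<Sum>(i, j)\<in>{(n, l), (l, n)}. (norm (y i - y j))\<^sup>2)
      \<le> (\<Sum>(i, j)\<in>parcs G. (norm (y i - y j))\<^sup>2)"
    using that arcs_symmetric[OF that] pair_finite_arcs by (intro sum_mono2) auto
  with \<open>n \<noteq> l\<close> show "(norm (y n - y l))\<^sup>2 \<le> dirichlet_energy G y"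
    by (simp add: dirichlet_energy_def norm_minus_commute)
qed

section \<open>Poincare-type inequalities from connectivity\<close>

text \<open>Telescoping along a path: each arc costs one root of the energy. The constant is chosen
  before \<open>y\<close> and depends only on the path.\<close>

lemma reachable_diff_le:
  assumes "n \<rightarrow>\<^sup>*\<^bsub>with_proj G\<^esub> m"
  shows "\<exists>C. \<forall>y :: 'a \<Rightarrow> 'b::real_inner. norm (y n - y m) \<le> C * sqrt (dirichlet_energy G y)"
  using assms
proof (induction rule: reachable_induct)
  case base
  show ?case by (intro exI[of _ 0]) simp
next
  case (step k m)
  then obtain C where C: "\<And>y :: 'a \<Rightarrow> 'b. norm (y n - y k) \<le> C * sqrt (dirichlet_energy G y)"
    by blast
  have arc: "(k, m) \<in> parcs G" using step by simp
  have "norm (y n - y m) \<le> (C + 1) * sqrt (dirichlet_energy G y)" for y :: "'a \<Rightarrow> 'b"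
    using C[of y] arc_diff_le[OF arc, of y] norm_triangle_ineq[of "y n - y k" "y k - y m"]
    by (simp add: algebra_simps)
  then show ?case by blast
qed

lemma connected_diff_le:
  assumes "Digraph_Component.connected (with_proj G)"
  obtains C where "C > 0"
    and "\<And>(y :: 'a \<Rightarrow> 'b::real_inner) n m. n \<in> pverts G \<Longrightarrow> m \<in> pverts G \<Longrightarrow>
      norm (y n - y m) \<le> C * sqrt (dirichlet_energy G y)"
proof -
  have reach: "n \<rightarrow>\<^sup>*\<^bsub>with_proj G\<^esub> m" if "n \<in> pverts G" "m \<in> pverts G" for n m
    using assms that reachable_mk_symmetric_eq[OF pair_sym_arcs]
    by (auto simp: connected_def strongly_connected_def)
  define A where "A = pverts G \<times> pverts G"
  have "\<exists>C. \<forall>p\<in>A. \<forall>y :: 'a \<Rightarrow> 'b.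
      norm (y (fst p) - y (snd p)) \<le> C p * sqrt (dirichlet_energy G y)"
    by (rule bchoice) (auto simp: A_def intro!: reachable_diff_le reach)
  then obtain C where C: "\<And>p (y :: 'a \<Rightarrow> 'b). p \<in> A \<Longrightarrow>
      norm (y (fst p) - y (snd p)) \<le> C p * sqrt (dirichlet_energy G y)"
    by blast
  have finA: "finite A" by (simp add: A_def pair_finite_verts)
  \<comment> \<open>One constant dominating those of all finitely many pairs; the summand 1 makes it
    positive.\<close>
  define B where "B = (\<Sum>p\<in>A. \<bar>C p\<bar>) + 1"
  show ?thesis
  proof (rule that)
    show "B > 0" by (simp add: B_def add_nonneg_pos sum_nonneg)
    fix y :: "'a \<Rightarrow> 'b" and n m assume nm: "n \<in> pverts G" "m \<in> pverts G"
    then have "(n, m) \<in> A" by (simp add: A_def)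
    then have "\<bar>C (n, m)\<bar> \<le> (\<Sum>p\<in>A. \<bar>C p\<bar>)"
      using finA by (intro member_le_sum) auto
    then have "C (n, m) \<le> B" by (simp add: B_def)
    then show "norm (y n - y m) \<le> B * sqrt (dirichlet_energy G y)"
      using C[OF \<open>(n, m) \<in> A\<close>, of y] dirichlet_energy_nonneg[of G y]
      by (smt (verit) fst_conv snd_conv mult_right_mono real_sqrt_ge_zero)
  qed
qed

text \<open>A spectral gap without eigenvalues: the energy pairs the differences to a fixed vertex
  with the Laplacian, those differences are of order \<open>sqrt Q\<close>, and one such factor
  cancels.\<close>

lemma dirichlet_energy_le_laplacian:
  assumes "Digraph_Component.connected (with_proj G)"
  obtains \<mu> where "\<mu> > 0"
    and "\<And>y :: 'a \<Rightarrow> 'b::real_inner.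
      \<mu> * dirichlet_energy G y \<le> (\<Sum>n\<in>pverts G. (norm (laplacian G y n))\<^sup>2)"
proof -
  obtain C where C: "C > 0" and diff: "\<And>(y :: 'a \<Rightarrow> 'b) n m. n \<in> pverts G \<Longrightarrow> m \<in> pverts G \<Longrightarrow>
      norm (y n - y m) \<le> C * sqrt (dirichlet_energy G y)"
    using connected_diff_le[OF assms] by metis
  have "pverts G \<noteq> {}"
    using assms by (auto simp: connected_def strongly_connected_def)
  then obtain k where k: "k \<in> pverts G" by blast
  define N where "N = real (card (pverts G))"
  have N: "N > 0"
    using k pair_finite_verts by (auto simp: N_def card_gt_0_iff)
  show ?thesis
  proof (rule that)
    show "1 / (C\<^sup>2 * N) > 0" using C N by simp
    fix y :: "'a \<Rightarrow> 'b"
    define Q where "Q = dirichlet_energy G y"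
    define s where "s = (\<Sum>n\<in>pverts G. norm (laplacian G y n))"
    have Q: "Q \<ge> 0" unfolding Q_def by (rule dirichlet_energy_nonneg)
    \<comment> \<open>Shifting by the constant \<open>y k\<close> leaves the edge differences in the
      Green identity unchanged.\<close>
    have "Q = (\<Sum>n\<in>pverts G. inner (y n - y k) (laplacian G y n))"
      unfolding sum_inner_laplacian Q_def dirichlet_energy_def by (simp add: power2_norm_eq_inner)
    also have "\<dots> \<le> (\<Sum>n\<in>pverts G. (C * sqrt Q) * norm (laplacian G y n))"
      using diff k unfolding Q_def
      by (intro sum_mono) (meson norm_cauchy_schwarz mult_right_mono norm_ge_zero order_trans)
    also have "\<dots> = C * sqrt Q * s"
      by (simp add: sum_distrib_left s_def)
    finally have "sqrt Q * sqrt Q \<le> sqrt Q * (C * s)"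
      using Q by (simp add: mult_ac)
    moreover have "s \<ge> 0" by (simp add: s_def sum_nonneg)
    ultimately have "sqrt Q \<le> C * s"
      using Q C by (cases "Q = 0") (auto simp del: real_sqrt_mult_self)
    then have "(sqrt Q)\<^sup>2 \<le> (C * s)\<^sup>2"
      using Q by (intro power_mono) auto
    then have "Q \<le> C\<^sup>2 * s\<^sup>2"
      using Q by (simp add: power_mult_distrib)
    also have "\<dots> \<le> C\<^sup>2 * (N * (\<Sum>n\<in>pverts G. (norm (laplacian G y n))\<^sup>2))"
      using sum_squared_le_sum_of_squares[of "\<lambda>n. norm (laplacian G y n)" "pverts G"]
      by (intro mult_left_mono) (auto simp: s_def N_def mult.commute)
    finally show "1 / (C\<^sup>2 * N) * dirichlet_energy G y
        \<le> (\<Sum>n\<in>pverts G. (norm (laplacian G y n))\<^sup>2)"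
      using C N by (simp add: Q_def field_simps)
  qed
qed

text \<open>Differentiate edge by edge and return to vertices by the Green identity with the
  velocities as test function.\<close>

lemma dirichlet_energy_has_derivative:
  fixes x :: "'a \<Rightarrow> real \<Rightarrow> 'b::real_inner"
  assumes "\<And>n. n \<in> pverts G \<Longrightarrow> (x n has_vector_derivative x' n) (at t)"
  shows "((\<lambda>t. dirichlet_energy G (\<lambda>n. x n t)) has_real_derivative
    2 * (\<Sum>n\<in>pverts G. inner (x' n) (laplacian G (\<lambda>n. x n t) n))) (at t)"
proof -
  have "((\<lambda>t. (norm (x n t - x l t))\<^sup>2) has_real_derivative
      2 * inner (x' n - x' l) (x n t - x l t)) (at t)" if "(n, l) \<in> parcs G" for n l
  proof -
    have "n \<in> pverts G" "l \<in> pverts G"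
      using arc_fst_in_verts[OF that] arc_snd_in_verts[OF that] by auto
    then have "((\<lambda>t. x n t - x l t) has_vector_derivative x' n - x' l) (at t)"
      using assms by (intro has_vector_derivative_diff)
    moreover have "GDERIV (\<lambda>u. inner u u) (x n t - x l t) :> 2 *\<^sub>R (x n t - x l t)"
      unfolding gderiv_def by (auto intro!: derivative_eq_intros simp: inner_commute)
    ultimately show ?thesis
      using GDERIV_vector_derivative_compose by (fastforce simp: power2_norm_eq_inner)
  qed
  then have "((\<lambda>t. \<Sum>p\<in>parcs G. (norm (x (fst p) t - x (snd p) t))\<^sup>2) has_real_derivative
      (\<Sum>p\<in>parcs G. 2 * inner (x' (fst p) - x' (snd p)) (x (fst p) t - x (snd p) t))) (at t)"
    by (intro DERIV_sum) auto
  from DERIV_cdivide[OF this, of 2] show ?thesis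
    unfolding sum_inner_laplacian dirichlet_energy_def
    by (simp add: case_prod_beta sum_distrib_left)
qed

end

section \<open>The Lyapunov function of the flow\<close>

text \<open>The exponents \<open>a\<close> and \<open>b\<close> stand for
  \<open>\<tau>\<^sub>\<alpha>\<close> and \<open>\<tau>\<^sub>\<beta>\<close>. The equation is
  imposed for positive times, where derivatives are two-sided.\<close>

locale distributed_gradient_flow = pair_graph G
  for G :: "'v pair_pre_digraph" +
  fixes f :: "'v \<Rightarrow> 'a::euclidean_space \<Rightarrow> real"
    and x :: "'v \<Rightarrow> real \<Rightarrow> 'a"
    and a b K :: real and m :: "'v \<Rightarrow> real"
  assumes conn: "Digraph_Component.connected (with_proj G)"
    and f: "n \<in> pverts G \<Longrightarrow> GDERIV (f n) z :> gradient (f n) z"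
    and m_le: "n \<in> pverts G \<Longrightarrow> m n \<le> f n z"
    and lip: "n \<in> pverts G \<Longrightarrow> K-lipschitz_on UNIV (gradient (f n))"
    and K: "K > 0"
    and ab: "b < a" and a: "a \<le> 1"
    and flow: "n \<in> pverts G \<Longrightarrow> t > 0 \<Longrightarrow> (x n has_vector_derivative
      - ((t + 1) powr (- b)) *\<^sub>R laplacian G (\<lambda>l. x l t) n
      - (t + 1) powr (- a) *\<^sub>R gradient (f n) (x n t)) (at t)"
begin

definition N :: real where "N = card (pverts G)"
definition lap :: "'v \<Rightarrow> real \<Rightarrow> 'a" where "lap n t = laplacian G (\<lambda>l. x l t) n"
definition grd :: "'v \<Rightarrow> real \<Rightarrow> 'a" where "grd n t = gradient (f n) (x n t)"
definition vel :: "'v \<Rightarrow> real \<Rightarrow> 'a" where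
  "vel n t = - ((t + 1) powr (- b)) *\<^sub>R lap n t - (t + 1) powr (- a) *\<^sub>R grd n t"
definition Q :: "real \<Rightarrow> real" where "Q t = dirichlet_energy G (\<lambda>l. x l t)"
definition F :: "real \<Rightarrow> real" where "F t = (\<Sum>n\<in>pverts G. f n (x n t) - m n)"
definition mean :: "real \<Rightarrow> 'a" where "mean t = (1 / N) *\<^sub>R (\<Sum>n\<in>pverts G. x n t)"
definition total_gradient :: "'a \<Rightarrow> 'a" where
  "total_gradient z = (\<Sum>n\<in>pverts G. gradient (f n) z)"

lemma N_pos: "N > 0"
  using conn pair_finite_verts by (auto simp: N_def connected_def strongly_connected_def card_gt_0_iff)

lemma x_has_derivative: "n \<in> pverts G \<Longrightarrow> t > 0 \<Longrightarrow> (x n has_vector_derivative vel n t) (at t)"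
  using flow unfolding vel_def lap_def grd_def .

lemma Q_nonneg: "Q t \<ge> 0"
  unfolding Q_def by (rule dirichlet_energy_nonneg)

lemma F_nonneg: "F t \<ge> 0"
  unfolding F_def using m_le by (intro sum_nonneg) (simp add: m_le)

lemma f_le_F: "n \<in> pverts G \<Longrightarrow> f n (x n t) - m n \<le> F t"
  unfolding F_def using m_le pair_finite_verts by (intro member_le_sum) auto

lemma Q_has_derivative:
  assumes "t > 0"
  shows "(Q has_real_derivative 2 * (\<Sum>n\<in>pverts G. inner (vel n t) (lap n t))) (at t)"
  using dirichlet_energy_has_derivative[of x "\<lambda>n. vel n t" t] x_has_derivative assms
  unfolding Q_def[abs_def] lap_def by blast

lemma F_has_derivative:
  assumes "t > 0"
  shows "(F has_real_derivative (\<Sum>n\<in>pverts G. inner (vel n t) (grd n t))) (at t)"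
proof -
  have "((\<lambda>t. f n (x n t) - m n) has_real_derivative inner (vel n t) (grd n t)) (at t)"
    if "n \<in> pverts G" for n
    using GDERIV_vector_derivative_compose[OF f[OF that] x_has_derivative[OF that assms]]
    by (auto intro!: derivative_eq_intros simp: grd_def)
  then show ?thesis
    unfolding F_def[abs_def] by (rule DERIV_sum)
qed

lemma sum_norm_grd_squared_le: "(\<Sum>n\<in>pverts G. (norm (grd n t))\<^sup>2) \<le> 4 * K * F t"
  unfolding F_def grd_def sum_distrib_left
  by (intro sum_mono norm_gradient_squared_le f lip K m_le)

text \<open>Half of the Laplacian dissipation absorbs the cross term with the gradients; the
  spectral gap turns the other half into decay of \<open>Q\<close>.\<close>

lemma Q_derivative_le:
  assumes "t > 0" and gap: "\<mu> * Q t \<le> (\<Sum>n\<in>pverts G. (norm (lap n t))\<^sup>2)"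
  shows "2 * (\<Sum>n\<in>pverts G. inner (vel n t) (lap n t))
    \<le> - ((t + 1) powr (- b)) * \<mu> * Q t + (t + 1) powr (b - 2 * a) * (4 * K * F t)"
proof -
  define \<alpha> \<beta> where "\<alpha> = (t + 1) powr (- a)" and "\<beta> = (t + 1) powr (- b)"
  have pos: "\<alpha> > 0" "\<beta> > 0" using assms by (auto simp: \<alpha>_def \<beta>_def)
  have ratio: "\<alpha>\<^sup>2 / \<beta> = (t + 1) powr (b - 2 * a)"
    using assms by (simp add: \<alpha>_def \<beta>_def power2_eq_square powr_add[symmetric] powr_diff[symmetric])
  \<comment> \<open>\<open>2 \<alpha> \<bar>g\<bar> \<bar>L\<bar> \<le> \<beta> \<bar>L\<bar>\<^sup>2 + (\<alpha>\<^sup>2 / \<beta>) \<bar>g\<bar>\<^sup>2\<close>\<close>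
  have young: "2 * inner (vel n t) (lap n t) \<le> - \<beta> * (norm (lap n t))\<^sup>2 + \<alpha>\<^sup>2 / \<beta> * (norm (grd n t))\<^sup>2" for n
  proof -
    have "- inner (grd n t) (lap n t) \<le> norm (grd n t) * norm (lap n t)"
      by (metis inner_minus_left norm_cauchy_schwarz norm_minus_cancel)
    then have "2 * \<alpha> * - inner (grd n t) (lap n t) \<le> 2 * \<alpha> * (norm (grd n t) * norm (lap n t))"
      using pos by (intro mult_left_mono) auto
    also have "2 * \<alpha> * (norm (grd n t) * norm (lap n t))
        = (\<beta>\<^sup>2 * (norm (lap n t))\<^sup>2 + \<alpha>\<^sup>2 * (norm (grd n t))\<^sup>2 - (\<beta> * norm (lap n t) - \<alpha> * norm (grd n t))\<^sup>2) / \<beta>"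
      using pos by (simp add: power2_eq_square field_simps)
    also have "\<dots> \<le> (\<beta>\<^sup>2 * (norm (lap n t))\<^sup>2 + \<alpha>\<^sup>2 * (norm (grd n t))\<^sup>2) / \<beta>"
      using pos by (intro divide_right_mono) auto
    also have "\<dots> = \<beta> * (norm (lap n t))\<^sup>2 + \<alpha>\<^sup>2 / \<beta> * (norm (grd n t))\<^sup>2"
      using pos by (simp add: power2_eq_square field_simps)
    finally show ?thesis
      by (simp add: vel_def \<alpha>_def \<beta>_def inner_diff_left power2_norm_eq_inner algebra_simps)
  qed
  have "2 * (\<Sum>n\<in>pverts G. inner (vel n t) (lap n t))
      \<le> (\<Sum>n\<in>pverts G. - \<beta> * (norm (lap n t))\<^sup>2 + \<alpha>\<^sup>2 / \<beta> * (norm (grd n t))\<^sup>2)"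
    unfolding sum_distrib_left by (intro sum_mono young)
  also have "\<dots> = - \<beta> * (\<Sum>n\<in>pverts G. (norm (lap n t))\<^sup>2) + \<alpha>\<^sup>2 / \<beta> * (\<Sum>n\<in>pverts G. (norm (grd n t))\<^sup>2)"
    by (simp only: sum.distrib sum_distrib_left)
  also have "\<dots> \<le> - \<beta> * (\<mu> * Q t) + \<alpha>\<^sup>2 / \<beta> * (4 * K * F t)"
    using pos gap sum_norm_grd_squared_le by (intro add_mono mult_left_mono mult_left_mono_neg) auto
  finally show ?thesis
    unfolding ratio by (simp add: \<beta>_def mult.assoc)
qed

text \<open>The coupling cancels in the sum, so only the gradients move the mean.\<close>

lemma sum_vel: "(\<Sum>n\<in>pverts G. vel n t) = - ((t + 1) powr (- a)) *\<^sub>R (\<Sum>n\<in>pverts G. grd n t)"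
  using sum_laplacian[of "\<lambda>l. x l t"]
  by (simp add: vel_def lap_def sum_subtractf scaleR_sum_right[symmetric] sum_negf)

lemma norm_sum_grd_squared_le:
  assumes "t > 0"
  shows "(t + 1) powr (- a) / N * (norm (\<Sum>n\<in>pverts G. grd n t))\<^sup>2
    \<le> (t + 1) powr a * (\<Sum>n\<in>pverts G. (norm (vel n t))\<^sup>2)"
proof -
  have "((t + 1) powr (- a))\<^sup>2 * (norm (\<Sum>n\<in>pverts G. grd n t))\<^sup>2
      \<le> N * (\<Sum>n\<in>pverts G. (norm (vel n t))\<^sup>2)"
    using norm_sum_squared_le[of "\<lambda>n. vel n t" "pverts G"]
    by (simp add: sum_vel N_def power_mult_distrib)
  then have "(t + 1) powr a / N * (((t + 1) powr (- a))\<^sup>2 * (norm (\<Sum>n\<in>pverts G. grd n t))\<^sup>2)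
      \<le> (t + 1) powr a / N * (N * (\<Sum>n\<in>pverts G. (norm (vel n t))\<^sup>2))"
    using N_pos by (intro mult_left_mono) auto
  moreover have "(t + 1) powr a * ((t + 1) powr (- a))\<^sup>2 = (t + 1) powr (- a)"
    using assms by (simp add: power2_eq_square powr_add[symmetric])
  ultimately show ?thesis
    using N_pos by (simp add: mult.assoc[symmetric])
qed

text \<open>The perturbed energy \<open>P\<close> decreases up to an integrable multiple of itself,
  which the integrating factor \<open>exp (H t)\<close> removes. This factor is at least 1, so the
  dissipation and the lower bound survive.\<close>

lemma lyapunov_function:
  obtains Z Z' :: "real \<Rightarrow> real"
  where "\<And>t. t > 0 \<Longrightarrow> (Z has_real_derivative Z' t) (at t)"
    and "\<And>t. t > 0 \<Longrightarrow> Z' t \<le> - (1 / N) * (t + 1) powr (- a) * (norm (\<Sum>n\<in>pverts G. grd n t))\<^sup>2"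
    and "\<And>t. t > 0 \<Longrightarrow> F t + (t + 1) powr (a - b) / 2 * Q t \<le> Z t"
proof -
  obtain \<mu> where \<mu>: "\<mu> > 0" and "\<And>y :: 'v \<Rightarrow> 'a.
      \<mu> * dirichlet_energy G y \<le> (\<Sum>n\<in>pverts G. (norm (laplacian G y n))\<^sup>2)"
    using dirichlet_energy_le_laplacian[OF conn] by metis
  then have gap: "\<mu> * Q t \<le> (\<Sum>n\<in>pverts G. (norm (lap n t))\<^sup>2)" for t
    by (simp add: Q_def lap_def)
  define \<delta> where "\<delta> = a - b"
  \<comment> \<open>With this \<open>c\<close> the decay of \<open>c (t + 1)\<^bsup>a - 1\<^esup> Q\<close> exactly absorbs the growth \<open>\<gamma>' Q / 2\<close>
    caused by the time dependence of \<open>\<gamma>\<close>; the weight itself is nonincreasing because \<open>a \<le> 1\<close>.\<close>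
  define c where "c = \<delta> / (2 * \<mu>)"
  have \<delta>: "\<delta> > 0" using ab by (simp add: \<delta>_def)
  have c: "c > 0" using \<delta> \<mu> by (simp add: c_def)
  define P where "P t = F t + ((t + 1) powr \<delta> / 2 + c * (t + 1) powr (a - 1)) * Q t" for t
  define F' where "F' t = (\<Sum>n\<in>pverts G. inner (vel n t) (grd n t))" for t
  define Q' where "Q' t = 2 * (\<Sum>n\<in>pverts G. inner (vel n t) (lap n t))" for t
  define P' where "P' t = F' t + ((t + 1) powr \<delta> / 2 + c * (t + 1) powr (a - 1)) * Q' t
    + (\<delta> * (t + 1) powr (\<delta> - 1) / 2 + c * ((a - 1) * (t + 1) powr (a - 2))) * Q t" for t
  \<comment> \<open>The integral from \<open>t\<close> to infinity of the error rate
    \<open>- H'\<close>; it is finite since \<delta> is positive.\<close>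
  define H where "H t = 4 * K * c / \<delta> * (t + 1) powr (- \<delta>)" for t
  define H' where "H' t = - (4 * K * c) * (t + 1) powr (- \<delta> - 1)" for t
  define V where "V t = (t + 1) powr a * (\<Sum>n\<in>pverts G. (norm (vel n t))\<^sup>2)" for t
  have P: "(P has_real_derivative P' t) (at t)" if "t > 0" for t
    using that Q_has_derivative[OF that] F_has_derivative[OF that] unfolding P_def[abs_def] P'_def
    by (auto intro!: derivative_eq_intros simp: F'_def Q'_def algebra_simps)
  have H: "(H has_real_derivative H' t) (at t)" if "t > 0" for t
    using that \<delta> unfolding H_def[abs_def] H'_def
    by (auto intro!: derivative_eq_intros)
  have P_ge: "F t + (t + 1) powr \<delta> / 2 * Q t \<le> P t" for t
    using c Q_nonneg[of t] by (simp add: P_def algebra_simps)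
  have F_le: "F t \<le> P t" for t
    using P_ge[of t] Q_nonneg[of t] by (smt (verit) divide_nonneg_nonneg mult_nonneg_nonneg powr_ge_zero)
  have P'_le: "P' t \<le> - V t - H' t * P t" if t: "t > 0" for t
  proof -
    \<comment> \<open>Gradient structure: with the weight frozen, each velocity is a negative
      multiple of the gradient of the energy.\<close>
    have "F' t + (t + 1) powr \<delta> / 2 * Q' t = - V t"
    proof -
      have "inner (vel n t) (grd n t) + (t + 1) powr \<delta> * inner (vel n t) (lap n t)
          = - ((t + 1) powr a) * (norm (vel n t))\<^sup>2" for n
      proof -
        have "grd n t + (t + 1) powr \<delta> *\<^sub>R lap n t = - ((t + 1) powr a) *\<^sub>R vel n t"
          using t by (simp add: vel_def \<delta>_def algebra_simps powr_add[symmetric])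
        then have "inner (vel n t) (grd n t + (t + 1) powr \<delta> *\<^sub>R lap n t)
            = - ((t + 1) powr a) * (norm (vel n t))\<^sup>2"
          by (simp add: power2_norm_eq_inner)
        then show ?thesis
          by (simp add: inner_add_right)
      qed
      then show ?thesis
        by (simp add: F'_def Q'_def V_def sum_distrib_left sum.distrib[symmetric] sum_negf[symmetric])
    qed
    \<comment> \<open>The exponent \<open>a - 1\<close> turns the decay rate of \<open>Q\<close>
      into the power \<delta> - 1 of the growing weight's derivative, and leaves the integrable
      power - \<delta> - 1 in front of \<open>F\<close>.\<close>
    moreover have "c * (t + 1) powr (a - 1) * Q' t
        \<le> - (\<delta> * (t + 1) powr (\<delta> - 1) / 2) * Q t - H' t * F t"
    proof -
      have "c * (t + 1) powr (a - 1) * Q' t \<le> c * (t + 1) powr (a - 1) *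
          (- ((t + 1) powr (- b)) * \<mu> * Q t + (t + 1) powr (b - 2 * a) * (4 * K * F t))"
        unfolding Q'_def using c t gap by (intro mult_left_mono Q_derivative_le) auto
      also have "\<dots> = - (c * \<mu>) * ((t + 1) powr (a - 1) * (t + 1) powr (- b)) * Q t
          + 4 * K * c * ((t + 1) powr (a - 1) * (t + 1) powr (b - 2 * a)) * F t"
        by (simp add: algebra_simps)
      also have "(t + 1) powr (a - 1) * (t + 1) powr (- b) = (t + 1) powr (\<delta> - 1)"
        by (simp add: powr_add[symmetric] \<delta>_def algebra_simps)
      also have "(t + 1) powr (a - 1) * (t + 1) powr (b - 2 * a) = (t + 1) powr (- \<delta> - 1)"
        by (simp add: powr_add[symmetric] \<delta>_def algebra_simps)
      also have "c * \<mu> = \<delta> / 2"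
        using \<mu> by (simp add: c_def)
      finally show ?thesis
        by (simp add: H'_def)
    qed
    moreover have "c * ((a - 1) * (t + 1) powr (a - 2)) * Q t \<le> 0"
      using c a Q_nonneg[of t] by (simp add: mult_nonneg_nonpos mult_nonpos_nonneg mult_nonneg_nonpos2)
    moreover have "- H' t * F t \<le> - H' t * P t"
      using F_le K c by (intro mult_left_mono) (auto simp: H'_def)
    ultimately show ?thesis
      by (simp add: P'_def algebra_simps)
  qed
  define Z where "Z t = exp (H t) * P t" for t
  show ?thesis
  proof (rule that)
    fix t :: real assume t: "t > 0"
    show "(Z has_real_derivative exp (H t) * (P' t + H' t * P t)) (at t)"
      using P[OF t] H[OF t] unfolding Z_def[abs_def]
      by (auto intro!: derivative_eq_intros simp: algebra_simps)
    have H1: "exp (H t) \<ge> 1"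
      using K c \<delta> by (simp add: H_def)
    have V: "V t \<ge> 0"
      by (simp add: V_def sum_nonneg)
    have "exp (H t) * (P' t + H' t * P t) \<le> exp (H t) * (- V t)"
      using P'_le[OF t] by (intro mult_left_mono) auto
    also have "\<dots> \<le> - V t"
      using H1 V by (simp add: mult_le_cancel_right1)
    also have "\<dots> \<le> - (1 / N) * (t + 1) powr (- a) * (norm (\<Sum>n\<in>pverts G. grd n t))\<^sup>2"
      using norm_sum_grd_squared_le[OF t] by (simp add: V_def)
    finally show "exp (H t) * (P' t + H' t * P t)
        \<le> - (1 / N) * (t + 1) powr (- a) * (norm (\<Sum>n\<in>pverts G. grd n t))\<^sup>2" .
    have "P t \<le> Z t"
      using H1 F_le[of t] F_nonneg[of t] by (simp add: Z_def mult_le_cancel_right1)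
    then show "F t + (t + 1) powr (a - b) / 2 * Q t \<le> Z t"
      using P_ge[of t] by (simp add: \<delta>_def)
  qed
qed

section \<open>Boundedness, consensus and critical points\<close>

lemma energy_bounded:
  obtains B where "\<And>t. t \<ge> 1 \<Longrightarrow> F t + (t + 1) powr (a - b) / 2 * Q t \<le> B"
proof -
  obtain Z Z' where Z: "\<And>t. t > 0 \<Longrightarrow> (Z has_real_derivative Z' t) (at t)"
    and Z': "\<And>t. t > 0 \<Longrightarrow> Z' t \<le> - (1 / N) * (t + 1) powr (- a) * (norm (\<Sum>n\<in>pverts G. grd n t))\<^sup>2"
    and Z_ge: "\<And>t. t > 0 \<Longrightarrow> F t + (t + 1) powr (a - b) / 2 * Q t \<le> Z t"
    using lyapunov_function by metis
  have "Z' t \<le> 0" if "t > 0" for t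
  proof -
    have "0 \<le> 1 / N * (t + 1) powr (- a) * (norm (\<Sum>n\<in>pverts G. grd n t))\<^sup>2"
      using N_pos by simp
    then show ?thesis using Z'[OF that] by simp
  qed
  then have "Z t \<le> Z 1" if "t \<ge> 1" for t
    using that Z by (intro DERIV_nonpos_imp_nonincreasing[of 1 t Z]) (meson less_le_trans zero_less_one)+
  then show ?thesis
    using that[of "Z 1"] Z_ge by (metis order_trans zero_less_one less_le_trans)
qed

text \<open>The weight of \<open>Q\<close> in the bounded energy tends to infinity because
  \<open>b < a\<close>, which forces \<open>Q\<close> to 0 at rate
  \<open>(t + 1) powr (b - a)\<close>; connectivity controls all pairs.\<close>

lemma consensus:
  assumes "n \<in> pverts G" "l \<in> pverts G"
  shows "((\<lambda>t. x n t - x l t) \<longlongrightarrow> 0) at_top"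
proof -
  obtain B where B: "\<And>t. t \<ge> 1 \<Longrightarrow> F t + (t + 1) powr (a - b) / 2 * Q t \<le> B"
    using energy_bounded by blast
  have Q_le: "Q t \<le> 2 * B * (t + 1) powr (b - a)" if "t \<ge> 1" for t
  proof -
    have "(t + 1) powr (a - b) / 2 * Q t \<le> B"
      using B[OF that] F_nonneg[of t] by linarith
    then have "(t + 1) powr (b - a) * 2 * ((t + 1) powr (a - b) / 2 * Q t) \<le> (t + 1) powr (b - a) * 2 * B"
      by (intro mult_left_mono) auto
    moreover have "(t + 1) powr (b - a) * (t + 1) powr (a - b) = 1"
      using that by (simp add: powr_add[symmetric])
    ultimately show ?thesis
      by (simp add: mult_ac)
  qed
  have "((\<lambda>t. 2 * B * (t + 1) powr (b - a)) \<longlongrightarrow> 0) at_top"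
    using ab by real_asymp
  then have "(Q \<longlongrightarrow> 0) at_top"
    by (rule Lim_null_comparison[rotated])
      (auto simp: eventually_at_top_linorder Q_nonneg intro!: exI[of _ 1] Q_le)
  then have lim: "((\<lambda>t. C * sqrt (Q t)) \<longlongrightarrow> 0) at_top" for C
    by (auto intro!: tendsto_eq_intros)
  obtain C where "\<And>(y :: 'v \<Rightarrow> 'a) n m. n \<in> pverts G \<Longrightarrow> m \<in> pverts G \<Longrightarrow>
      norm (y n - y m) \<le> C * sqrt (dirichlet_energy G y)"
    using connected_diff_le[OF conn] by metis
  from this[OF assms, of "\<lambda>k. x k t" for t] have "norm (x n t - x l t) \<le> C * sqrt (Q t)" for t
    by (simp add: Q_def)
  then show ?thesis
    by (intro Lim_null_comparison[OF always_eventually lim]) blast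
qed

lemma diff_mean_tendsto_0:
  assumes "n \<in> pverts G"
  shows "((\<lambda>t. x n t - mean t) \<longlongrightarrow> 0) at_top"
proof -
  have "x n t - mean t = (1 / N) *\<^sub>R (\<Sum>l\<in>pverts G. x n t - x l t)" for t
    using N_pos assms by (auto simp: mean_def sum_subtractf N_def sum_constant_scaleR scaleR_diff_right)
  moreover have "((\<lambda>t. \<Sum>l\<in>pverts G. x n t - x l t) \<longlongrightarrow> 0) at_top"
    using consensus assms by (intro tendsto_null_sum) auto
  from tendsto_scaleR[OF tendsto_const this, of "1 / N"]
  have "((\<lambda>t. (1 / N) *\<^sub>R (\<Sum>l\<in>pverts G. x n t - x l t)) \<longlongrightarrow> 0) at_top"
    by simp
  ultimately show ?thesis
    by simp
qed

lemma total_gradient_lipschitz: "(N * K)-lipschitz_on UNIV total_gradient"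
proof (rule lipschitz_onI)
  fix y z :: 'a
  have "norm (total_gradient y - total_gradient z) \<le> (\<Sum>n\<in>pverts G. K * norm (y - z))"
    unfolding total_gradient_def sum_subtractf[symmetric]
    using lipschitz_onD[OF lip] by (intro sum_norm_le) (simp add: dist_norm)
  then show "dist (total_gradient y) (total_gradient z) \<le> N * K * dist y z"
    by (simp add: dist_norm N_def)
qed (use N_pos K in simp)

text \<open>The dissipation argument applies to the mean: its speed is the step weight times a
  bounded gradient sum, and consensus identifies that sum with the total gradient at the mean in the
  limit.\<close>

lemma total_gradient_mean_tendsto_0: "((\<lambda>t. total_gradient (mean t)) \<longlongrightarrow> 0) at_top"
proof -
  obtain Z Z' where Z: "\<And>t. t > 0 \<Longrightarrow> (Z has_real_derivative Z' t) (at t)"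
    and Z': "\<And>t. t > 0 \<Longrightarrow> Z' t \<le> - (1 / N) * (t + 1) powr (- a) * (norm (\<Sum>n\<in>pverts G. grd n t))\<^sup>2"
    and Z_ge: "\<And>t. t > 0 \<Longrightarrow> F t + (t + 1) powr (a - b) / 2 * Q t \<le> Z t"
    using lyapunov_function by metis
  obtain B where B: "\<And>t. t \<ge> 1 \<Longrightarrow> F t + (t + 1) powr (a - b) / 2 * Q t \<le> B"
    using energy_bounded by blast
  obtain S where S: "\<And>t. t \<ge> 0 \<Longrightarrow> (S has_real_derivative (t + 1) powr (- a)) (at t)"
    and S_top: "filterlim S at_top at_top"
    using powr_antiderivative_at_top[OF a] by metis
  have E_nonneg: "0 \<le> (t + 1) powr (a - b) / 2 * Q t" for t
    using Q_nonneg by simp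
  define g where "g t = (\<Sum>n\<in>pverts G. grd n t)" for t
  have g_le: "norm (g t) \<le> sqrt (N * (4 * K * B))" if "t \<ge> 1" for t
  proof (rule real_le_rsqrt)
    have "F t \<le> B" using B[OF that] E_nonneg[of t] by linarith
    have "(norm (g t))\<^sup>2 \<le> N * (\<Sum>n\<in>pverts G. (norm (grd n t))\<^sup>2)"
      unfolding g_def N_def by (rule norm_sum_squared_le)
    also have "\<dots> \<le> N * (4 * K * B)"
      using \<open>F t \<le> B\<close> sum_norm_grd_squared_le[of t] N_pos K
      by (intro mult_left_mono) (auto intro: order_trans)
    finally show "(norm (g t))\<^sup>2 \<le> N * (4 * K * B)" .
  qed
  define mean' where "mean' t = (- ((t + 1) powr (- a)) / N) *\<^sub>R g t" for t
  show ?thesis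
  proof (rule tendsto_zero_if_dissipated[where w = total_gradient and y = mean and T = 1 and c = "1 / N" and g = g and y' = mean'
        and M = "sqrt (N * (4 * K * B)) / N" and S = S and K = "N * K" and \<alpha> = "\<lambda>t. (t + 1) powr (- a)" and Z = Z and Z' = Z'])
    show "1 / N > 0" using N_pos by simp
    show "filterlim S at_top at_top" by fact
    show "(N * K)-lipschitz_on UNIV total_gradient" by (rule total_gradient_lipschitz)
    have "((\<lambda>t. \<Sum>n\<in>pverts G. grd n t - gradient (f n) (mean t)) \<longlongrightarrow> 0) at_top"
      unfolding grd_def
      by (intro tendsto_null_sum lipschitz_diff_tendsto_0[OF lip] diff_mean_tendsto_0)
    then show "((\<lambda>t. g t - total_gradient (mean t)) \<longlongrightarrow> 0) at_top"
      by (simp add: g_def total_gradient_def sum_subtractf)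
  next
    fix t :: real assume "t \<ge> 1"
    then have t: "t > 0" "t \<ge> 0" by auto
    show "(Z has_real_derivative Z' t) (at t)" using Z t by blast
    show "Z' t \<le> - (1 / N) * (t + 1) powr (- a) * (norm (g t))\<^sup>2"
      using Z' t unfolding g_def by blast
    show "0 \<le> Z t"
      using Z_ge[OF t(1)] F_nonneg[of t] E_nonneg[of t] by linarith
    show "(t + 1) powr (- a) \<ge> 0" by simp
    show "(S has_real_derivative (t + 1) powr (- a)) (at t)" using S t by blast
    have "mean' t = (1 / N) *\<^sub>R (\<Sum>n\<in>pverts G. vel n t)"
      by (simp add: mean'_def g_def sum_vel)
    then show "(mean has_vector_derivative mean' t) (at t)"
      unfolding mean_def[abs_def] using x_has_derivative t
      by (auto intro!: derivative_eq_intros)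
    show "norm (mean' t) \<le> sqrt (N * (4 * K * B)) / N * (t + 1) powr (- a)"
    proof -
      have "norm (mean' t) = (t + 1) powr (- a) / N * norm (g t)"
        using N_pos by (simp add: mean'_def)
      also have "\<dots> \<le> (t + 1) powr (- a) / N * sqrt (N * (4 * K * B))"
        using g_le[OF \<open>t \<ge> 1\<close>] N_pos by (intro mult_left_mono) auto
      finally show ?thesis
        by (simp add: mult.commute)
    qed
  qed
qed

lemma critical_points_eq:
  "critical_points (\<lambda>y. \<Sum>n\<in>pverts G. f n y) = {z. total_gradient z = 0}"
  using gradient_sum[of "pverts G" f] f by (simp add: critical_points_def total_gradient_def)

text \<open>The energy bound confines \<open>x n\<close> to a sublevel set of \<open>f n\<close>,
  bounded by coercivity, and the vanishing gradient passes from the mean to \<open>x n\<close> by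
  Lipschitz continuity.\<close>

lemma converges_to_critical_points:
  assumes n: "n \<in> pverts G" and "coercive (f n)"
  shows "converges_to_set (x n) (critical_points (\<lambda>y. \<Sum>n\<in>pverts G. f n y))"
proof -
  obtain B where B: "\<And>t. t \<ge> 1 \<Longrightarrow> F t + (t + 1) powr (a - b) / 2 * Q t \<le> B"
    using energy_bounded by blast
  obtain R where R: "\<And>z. f n z \<le> B + m n \<Longrightarrow> norm z \<le> R"
    using coercive_bounded_sublevel[OF assms(2)] by blast
  have "norm (x n t) \<le> R" if "t \<ge> 1" for t
  proof (rule R)
    have "0 \<le> (t + 1) powr (a - b) / 2 * Q t"
      using Q_nonneg by simp
    then show "f n (x n t) \<le> B + m n"
      using B[OF that] f_le_F[OF n, of t] by linarith
  qed
  then have bdd: "eventually (\<lambda>t. norm (x n t) \<le> R) at_top"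
    unfolding eventually_at_top_linorder by blast
  have "((\<lambda>t. total_gradient (x n t)) \<longlongrightarrow> 0) at_top"
    using tendsto_add[OF lipschitz_diff_tendsto_0[OF total_gradient_lipschitz diff_mean_tendsto_0[OF n]]
        total_gradient_mean_tendsto_0]
    by simp
  then show ?thesis
    unfolding critical_points_eq
    using converges_to_set_zeros[OF _ bdd] lipschitz_on_continuous_on[OF total_gradient_lipschitz]
    by blast
qed

end

section \<open>From the stated hypotheses to the abstract flow\<close>

theorem theorem1:
  fixes N :: nat
    and G :: "nat pair_pre_digraph"
    and f :: "nat \<Rightarrow> real ^ 'd \<Rightarrow> real"
    and \<alpha> \<beta> :: "real \<Rightarrow> real"
    and \<tau>\<^sub>\<alpha> \<tau>\<^sub>\<beta> :: real
    and x :: "nat \<Rightarrow> real \<Rightarrow> real ^ 'd"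
  assumes "N \<ge> 1"
    and "pair_graph G"
    and "pverts G = {1..N}"
    and "Digraph_Component.connected (with_proj G)"
    and "\<And>n. n \<in> {1..N} \<Longrightarrow> C2 (f n)"
    and "\<And>n. n \<in> {1..N} \<Longrightarrow> coercive (f n)"
    and "\<And>n. n \<in> {1..N} \<Longrightarrow> \<exists>L. L-lipschitz_on UNIV (gradient (f n))"
    and "\<And>t. t \<ge> 0 \<Longrightarrow> \<alpha> t = (t + 1) powr (- \<tau>\<^sub>\<alpha>)"
    and "\<And>t. t \<ge> 0 \<Longrightarrow> \<beta> t = (t + 1) powr (- \<tau>\<^sub>\<beta>)"
    and "0 \<le> \<tau>\<^sub>\<beta>" and "\<tau>\<^sub>\<beta> < \<tau>\<^sub>\<alpha>" and "\<tau>\<^sub>\<alpha> \<le> 1"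
    and "dgf_solution G f \<alpha> \<beta> x"
  shows "\<forall>n\<in>{1..N}.
      (\<forall>l\<in>{1..N}. ((\<lambda>t. norm (x n t - x l t)) \<longlongrightarrow> 0) at_top) \<and>
      converges_to_set (x n) (critical_points (\<lambda>y. \<Sum>m=1..N. f m y))"
proof -
  interpret pair_graph G by fact
  have grad: "GDERIV (f n) z :> gradient (f n) z" if "n \<in> {1..N}" for n z
    using assms(5)[OF that] by (rule C2_GDERIV_gradient)
  have "\<exists>m. \<forall>z. m \<le> f n z" if n: "n \<in> {1..N}" for n
  proof -
    have "continuous_on UNIV (f n)"
      using grad[OF n] unfolding gderiv_def
      by (auto intro!: continuous_at_imp_continuous_on has_derivative_continuous)
    then show ?thesis
      using coercive_bounded_below[OF assms(6)[OF n]] by metis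
  qed
  then obtain m where m: "\<And>n z. n \<in> {1..N} \<Longrightarrow> m n \<le> f n z"
    by metis
  obtain L :: "nat \<Rightarrow> real" where L: "\<And>n. n \<in> {1..N} \<Longrightarrow> (L n)-lipschitz_on UNIV (gradient (f n))"
    using assms(7) by metis
  \<comment> \<open>A common positive Lipschitz constant for all nodes.\<close>
  define K where "K = (\<Sum>n=1..N. \<bar>L n\<bar>) + 1"
  have "K > 0"
    by (simp add: K_def add_nonneg_pos sum_nonneg)
  have lip: "K-lipschitz_on UNIV (gradient (f n))" if "n \<in> {1..N}" for n
  proof (rule lipschitz_on_le[OF L[OF that]])
    have "\<bar>L n\<bar> \<le> (\<Sum>n=1..N. \<bar>L n\<bar>)"
      using that by (intro member_le_sum) auto
    then show "L n \<le> K"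
      by (simp add: K_def)
  qed
  have flow: "(x n has_vector_derivative
      - ((t + 1) powr (- \<tau>\<^sub>\<beta>)) *\<^sub>R laplacian G (\<lambda>l. x l t) n
      - (t + 1) powr (- \<tau>\<^sub>\<alpha>) *\<^sub>R gradient (f n) (x n t)) (at t)"
    if "n \<in> {1..N}" "t > 0" for n t
  proof -
    have "(x n has_vector_derivative dgf_rhs G f \<alpha> \<beta> t (\<lambda>l. x l t) n) (at t within {0..})"
      using assms(13) that unfolding dgf_solution_def assms(3) by (metis less_imp_le)
    \<comment> \<open>A positive time is interior to the half-line, so the one-sided notion is
      relevant only at 0.\<close>
    moreover have "at t within {0..} = at t"
      using that by (intro at_within_interior) (simp add: interior_real_atLeast)
    moreover have "dgf_rhs G f \<alpha> \<beta> t (\<lambda>l. x l t) n =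
      - ((t + 1) powr (- \<tau>\<^sub>\<beta>)) *\<^sub>R laplacian G (\<lambda>l. x l t) n
      - (t + 1) powr (- \<tau>\<^sub>\<alpha>) *\<^sub>R gradient (f n) (x n t)"
    proof -
      have "(\<Sum>l\<in>neighbors G n. x l t - x n t) = - laplacian G (\<lambda>l. x l t) n"
        by (simp add: laplacian_def sum_negf[symmetric])
      then show ?thesis
        using that assms(8)[of t] assms(9)[of t] by (simp add: dgf_rhs_def)
    qed
    ultimately show ?thesis by simp
  qed
  interpret distributed_gradient_flow G f x \<tau>\<^sub>\<alpha> \<tau>\<^sub>\<beta> K m
    using assms(4,11,12) \<open>K > 0\<close> grad m lip flow by unfold_locales (auto simp: assms(3))
  show ?thesis
    using consensus converges_to_critical_points assms(6) tendsto_norm_zero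
    unfolding assms(3) by blast
qed

end
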